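(* For $n\ge 2$, let $T_n$ be the number of cars that have tried to park (successfully or not) before the Page parking process on $\{1,\dots,n\}$ is over. Then, when $n\to+\infty$, $$\frac{T_n}{n\log(n)}\to 1\quad\text{in probability.}$$
   Context: Definition of the (discrete-time) Page parking process on $\{1,\dots,n\}$, $n\ge 2$. It is a random sequence of configurations $x^t=(x^t_i)_{1\le i\le n}\in\{0,1\}^n$, $t=0,1,2,\dots$. Initially $x^0=(0,\dots,0)$. Given $x^t$, draw $i$ uniformly at random in $\{1,2,\dots,n-1\}$, independently of the past. If $(x^t_i,x^t_{i+1})=(0,0)$, then a car parks at $(i,i+1)$: $(x^{t+1}_i,x^{t+1}_{i+1})=(1,1)$ and the other $n-2$ coordinates are unchanged. If $(x^t_i,x^t_{i+1})\ne(0,0)$, nothing happens: $x^{t+1}=x^t$. The random time $T_n$ is the first $t$ at which parking is no longer possible, i.e. at which there is no $i\in\{1,\dots,n-1\}$ with $x^t_i=x^t_{i+1}=0$. Each time step corresponds to one car trying to park. *)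

theory Defs
  imports "HOL-Probability.Probability"
begin

text \<open>A configuration is a map from sites to \<open>{0, 1}\<close>. Only the sites \<open>1, \<dots>, n\<close> are relevant;
  draws lie in \<open>{1..n - 1}\<close>, so the other ones stay at \<open>0\<close> forever.\<close>

type_synonym configuration = "nat \<Rightarrow> nat"

definition try_park :: "nat \<Rightarrow> configuration \<Rightarrow> configuration" where
  "try_park i x = (if x i = 0 \<and> x (i + 1) = 0 then x(i := 1, i + 1 := 1) else x)"

text \<open>\<open>d t\<close> is the draw that leads from the configuration at time \<open>t\<close> to the one at time \<open>t + 1\<close>.\<close>

primrec page_process :: "(nat \<Rightarrow> nat) \<Rightarrow> nat \<Rightarrow> configuration" where
  "page_process d 0 = (\<lambda>_. 0)"
| "page_process d (Suc t) = try_park (d t) (page_process d t)"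

definition parking_possible :: "nat \<Rightarrow> configuration \<Rightarrow> bool" where
  "parking_possible n x \<longleftrightarrow> (\<exists>i\<in>{1..n - 1}. x i = 0 \<and> x (i + 1) = 0)"

text \<open>Since \<open>Inf {} = \<infinity>\<close> in \<^typ>\<open>enat\<close>, the value is \<open>\<infinity>\<close> if the process is never over.\<close>

definition parking_time :: "nat \<Rightarrow> (nat \<Rightarrow> nat) \<Rightarrow> enat" where
  "parking_time n d = Inf {enat t |t. \<not> parking_possible n (page_process d t)}"

definition iid_uniform_draws :: "'a measure \<Rightarrow> nat \<Rightarrow> (nat \<Rightarrow> 'a \<Rightarrow> nat) \<Rightarrow> bool" where
  "iid_uniform_draws M n D \<longleftrightarrow>
     prob_space M \<and>
     prob_space.indep_vars M (\<lambda>_. count_space {1..n - 1}) D UNIV \<and>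
     (\<forall>t. distr M (count_space {1..n - 1}) (D t) = uniform_count_measure {1..n - 1})"

text \<open>Each \<open>X n\<close> may live on its own probability space, and may take the values \<open>\<plusminus>\<infinity>\<close>, which count
  as far from the limit. Measurability is part of the notion because \<^const>\<open>measure\<close> is \<open>0\<close> on
  non-measurable sets.\<close>

definition tendsto_in_prob :: "(nat \<Rightarrow> 'a measure) \<Rightarrow> (nat \<Rightarrow> 'a \<Rightarrow> ereal) \<Rightarrow> real \<Rightarrow> bool" where
  "tendsto_in_prob M X c \<longleftrightarrow>
     (\<forall>\<^sub>F n in sequentially. prob_space (M n) \<and> X n \<in> borel_measurable (M n)) \<and>
     (\<forall>\<epsilon>>0. (\<lambda>n. measure (M n) {\<omega> \<in> space (M n). \<bar>X n \<omega> - ereal c\<bar> > ereal \<epsilon>}) \<longlonglongrightarrow> 0)"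

end

theory Submission
  imports Defs "HOL-Real_Asymp.Real_Asymp"
begin

text \<open>
  Number the \<open>N = n - 1\<close> possible draws \<open>1, \<dots>, N\<close>, so that draw \<open>i\<close> is the edge joining the sites
  \<open>i\<close> and \<open>i + 1\<close>. The parking time is sandwiched between two coupon collector problems, both of
  which take about \<open>n ln n\<close> draws.

  \<^emph>\<open>Upper bound.\<close> Once an edge has been drawn, its two sites are never both empty again. So if
  parking is still possible at time \<open>t\<close>, some edge has not been drawn before \<open>t\<close>, which has
  probability at most \<open>N (1 - 1/N)^t\<close> (\<open>prob_parking_time_gt\<close>). For \<open>t \<approx> (1 + \<delta>) n ln n\<close> this is of
  order \<open>n^(-\<delta>)\<close>.

  \<^emph>\<open>Lower bound.\<close> After a time of order \<open>n\<close>, a positive fraction of the edges is isolated: the two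
  sites are empty while both outer neighbours are occupied. The only way to fill such a pair is to
  draw exactly its edge, and by time \<open>(1 - \<delta>) n ln n\<close> a number of order at least \<open>n^\<delta>\<close> of these edges
  have still not been drawn. To make this quantitative, cut the edges into blocks of seven
  consecutive ones and let \<open>r\<close> be a small fraction of \<open>N\<close>. Prescribe for a block its full history up
  to time \<open>2 r\<close>: its second and its sixth edge are drawn once each, at given times \<open>a < r \<le> b < 2 r\<close>,
  and none of its edges at any other time in this period; prescribe furthermore that its middle
  edge is not drawn between \<open>2 r\<close> and \<open>t\<close>. The middle pair of such a block is empty at time \<open>t\<close>
  (\<open>guarded_pair_stays_empty\<close>), so the parking time exceeds \<open>t\<close>.

  All these events, indexed by the block and by the times \<open>a\<close> and \<open>b\<close>, restrict each draw separately.
  Their probabilities and those of their intersections are therefore products over time, and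
  comparing factor by factor shows that two of them are either disjoint or at most negligibly
  positively correlated: \<open>(1 - 7/N) ^ 2 \<ge> 1 - 14/N\<close> and \<open>(1 - 1/N) ^ 2 \<ge> 1 - 2/N\<close>, so only the times
  of the prescribed draws cost a factor, which is at most \<open>(1 - 7/N) ^ (-4)\<close> in total
  (\<open>guarded_events_almost_uncorrelated\<close>). As the expected number of events that occur is at
  least a constant times \<open>N (1 - 1/N)^t\<close>, Chebyshev's inequality shows that with high probability
  at least one of them does (\<open>prob_parking_time_le\<close>).
\<close>

section \<open>Configurations and the parking time\<close>

lemma occupied_step: "x j \<noteq> 0 \<Longrightarrow> try_park i x j \<noteq> 0"
  by (auto simp: try_park_def)

lemma occupied_mono:
  assumes "s \<le> t" "page_process d s j \<noteq> 0"
  shows "page_process d t j \<noteq> 0"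
  using assms by (induction t rule: dec_induct) (auto simp: occupied_step)

lemma drawn_edge_blocked:
  assumes "s < t" "d s = i"
  shows "page_process d t i \<noteq> 0 \<or> page_process d t (i + 1) \<noteq> 0"
proof -
  have "page_process d (Suc s) i \<noteq> 0 \<or> page_process d (Suc s) (i + 1) \<noteq> 0"
    using assms(2) by (auto simp: try_park_def)
  thus ?thesis
    using occupied_mono[of "Suc s" t d] assms(1) by (metis Suc_leI)
qed

lemma parking_over_mono:
  assumes "s \<le> t" "\<not> parking_possible n (page_process d s)"
  shows "\<not> parking_possible n (page_process d t)"
  using assms occupied_mono[OF assms(1), of d] unfolding parking_possible_def by metis

lemma parking_time_le_iff:
  "parking_time n d \<le> enat t \<longleftrightarrow> \<not> parking_possible n (page_process d t)"
proof
  assume le: "parking_time n d \<le> enat t"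
  let ?S = "{enat t |t. \<not> parking_possible n (page_process d t)}"
  obtain e where "e \<in> ?S"
  proof (cases "?S = {}")
    case True
    hence "parking_time n d = \<infinity>"
      unfolding parking_time_def by (simp add: top_enat_def)
    with le show ?thesis by simp
  qed blast
  hence "parking_time n d \<in> ?S"
    unfolding parking_time_def by (rule wellorder_InfI)
  then obtain s where "parking_time n d = enat s" "\<not> parking_possible n (page_process d s)"
    by blast
  with le show "\<not> parking_possible n (page_process d t)"
    using parking_over_mono[of s t n d] by simp
next
  assume "\<not> parking_possible n (page_process d t)"
  thus "parking_time n d \<le> enat t"
    unfolding parking_time_def by (intro Inf_lower) auto
qed

text \<open>
  The draw of \<open>i + 2\<close> at time \<open>a\<close> parks a car on \<open>i + 2, i + 3\<close> and the draw of \<open>i + 6\<close> at time \<open>b\<close> one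
  on \<open>i + 6, i + 7\<close>. From then on, draws of \<open>i + 3\<close> and \<open>i + 5\<close> are in vain, and only the draw of
  \<open>i + 4\<close> itself can fill the pair between the two cars. Edges \<open>i + 1\<close> and \<open>i + 7\<close> have to be avoided
  in the early phase because they compete with the two cars for their sites.
\<close>

lemma guarded_pair_stays_empty:
  fixes d :: "nat \<Rightarrow> nat"
  assumes "a \<noteq> b" "d a = i + 2" "d b = i + 6"
    and early: "\<And>u. u < s \<Longrightarrow> u \<noteq> a \<Longrightarrow> u \<noteq> b \<Longrightarrow> d u \<notin> {i + 1..i + 7}"
    and late: "\<And>u. s \<le> u \<Longrightarrow> u < t \<Longrightarrow> d u \<noteq> i + 4"
    and "a < s" "b < s" "s \<le> t"
  shows "page_process d t (i + 4) = 0 \<and> page_process d t (i + 5) = 0"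
proof -
  \<comment> \<open>Before \<open>a\<close> the edge of the left guard is empty, afterwards site \<open>i + 3\<close> shields the pair;
    likewise on the right with \<open>b\<close> and site \<open>i + 6\<close>.\<close>
  have inv: "page_process d u (i + 4) = 0 \<and> page_process d u (i + 5) = 0 \<and>
       (if u \<le> a then page_process d u (i + 2) = 0 \<and> page_process d u (i + 3) = 0
        else page_process d u (i + 3) = 1) \<and>
       (if u \<le> b then page_process d u (i + 6) = 0 \<and> page_process d u (i + 7) = 0
        else page_process d u (i + 6) = 1)" if "u \<le> t" for u
    using that
  proof (induction u)
    case 0
    thus ?case by simp
  next
    case (Suc u)
    consider "u = a" | "u = b" | "u < s" "u \<noteq> a" "u \<noteq> b" | "s \<le> u" by linarith
    thus ?case
    proof cases
      case 1
      moreover have [simp]: "Suc (Suc (Suc i)) = i + 3" by simp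
      ultimately show ?thesis using Suc assms by (auto simp: try_park_def)
    next
      case 2
      moreover have [simp]: "7 + i = i + 7" by simp
      ultimately show ?thesis using Suc assms by (auto simp: try_park_def)
    next
      case 3
      with early have "d u \<notin> {i + 1..i + 7}" by blast
      hence "page_process d (Suc u) (i + m) = page_process d u (i + m)" if "m \<in> {2..7}" for m
        using that by (auto simp: try_park_def)
      moreover have "Suc u \<le> a \<longleftrightarrow> u \<le> a" "Suc u \<le> b \<longleftrightarrow> u \<le> b" using 3 by linarith+
      moreover have "u \<le> t" using Suc.prems by simp
      ultimately show ?thesis
        using Suc.IH by (simp del: page_process.simps add_2_eq_Suc')
    next
      case 4
      with late Suc.prems have du: "d u \<noteq> i + 4" by simp
      have guards: "page_process d u (i + 3) = 1" "page_process d u (i + 6) = 1"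
        "page_process d u (i + 4) = 0" "page_process d u (i + 5) = 0"
        using Suc.IH Suc.prems 4 assms(6,7) by auto
      have "page_process d (Suc u) (i + m) = page_process d u (i + m)" if m: "m \<in> {3..6}" for m
      proof (cases "d u \<in> {i + 2..i + 6}")
        case True
        with du have "d u = i + 2 \<or> d u = i + 3 \<or> d u = i + 5 \<or> d u = i + 6" by auto
        moreover have "i + 2 + 1 = i + 3" "i + 5 + 1 = i + 6" by simp_all
        ultimately have "page_process d u (d u) \<noteq> 0 \<or> page_process d u (d u + 1) \<noteq> 0"
          using guards by (metis zero_neq_one)
        thus ?thesis by (auto simp: try_park_def)
      next
        case False
        with m show ?thesis by (auto simp: try_park_def)
      qed
      with guards have "page_process d (Suc u) (i + 3) = 1" "page_process d (Suc u) (i + 6) = 1"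
        "page_process d (Suc u) (i + 4) = 0" "page_process d (Suc u) (i + 5) = 0"
        by (simp_all del: page_process.simps)
      with 4 assms(6,7) show ?thesis by simp
    qed
  qed
  show ?thesis using inv[of t] by simp
qed

section \<open>A second moment bound\<close>

text \<open>
  Chebyshev's inequality for the number \<open>Y\<close> of events that occur: almost pairwise uncorrelated events
  (\<open>C\<close> close to \<open>1\<close>) with large expected number cannot all fail. The diagonal of the second moment
  contributes the expectation itself, whence the term \<open>1 / \<Sum>j. P(E j)\<close>.
\<close>

lemma (in prob_space) second_moment_bound:
  fixes E :: "'i \<Rightarrow> 'a set"
  assumes fin: "finite J" and E: "\<And>j. j \<in> J \<Longrightarrow> E j \<in> events"
    and corr: "\<And>i j. i \<in> J \<Longrightarrow> j \<in> J \<Longrightarrow> i \<noteq> j \<Longrightarrow>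
      prob (E i \<inter> E j) \<le> C * (prob (E i) * prob (E j))"
    and "C \<ge> 0" and pos: "(\<Sum>j\<in>J. prob (E j)) > 0"
  shows "prob (space M - (\<Union>j\<in>J. E j)) \<le> 1 / (\<Sum>j\<in>J. prob (E j)) + C - 1"
proof -
  define \<mu> where "\<mu> = (\<Sum>j\<in>J. prob (E j))"
  define Y where "Y = (\<lambda>\<omega>. \<Sum>j\<in>J. indicator (E j) \<omega> :: real)"
  have Y_meas [measurable]: "Y \<in> borel_measurable M"
    unfolding Y_def using E by simp
  have Ysq: "(Y \<omega>)\<^sup>2 = (\<Sum>i\<in>J. \<Sum>j\<in>J. indicator (E i \<inter> E j) \<omega>)" for \<omega>
    by (simp add: Y_def power2_eq_square sum_product indicator_inter_arith)
  have int: "integrable M (indicator A :: _ \<Rightarrow> real)" if "A \<in> events" for A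
    using that by (simp add: integrable_indicator_iff less_top[symmetric])
  have iY: "integrable M Y"
    unfolding Y_def using E int by auto
  have iY2: "integrable M (\<lambda>\<omega>. (Y \<omega>)\<^sup>2)"
    unfolding Ysq using E by (intro Bochner_Integration.integrable_sum int sets.Int)
  have EY: "expectation Y = \<mu>"
    unfolding Y_def \<mu>_def using E int
    by (subst Bochner_Integration.integral_sum) auto
  have "expectation (\<lambda>\<omega>. (Y \<omega>)\<^sup>2) = (\<Sum>i\<in>J. \<Sum>j\<in>J. prob (E i \<inter> E j))"
    unfolding Ysq using E int
    by (simp add: Bochner_Integration.integral_sum Bochner_Integration.integrable_sum sets.Int
        cong: sum.cong)
  also have "\<dots> \<le> (\<Sum>i\<in>J. \<Sum>j\<in>J. (if j = i then prob (E i) else 0) +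
      C * (prob (E i) * prob (E j)))"
    using corr \<open>C \<ge> 0\<close> by (intro sum_mono) auto
  also have "\<dots> = \<mu> + C * \<mu>\<^sup>2"
    using fin
    by (simp add: sum.distrib \<mu>_def power2_eq_square sum_product flip: sum_distrib_left)
  finally have EY2: "expectation (\<lambda>\<omega>. (Y \<omega>)\<^sup>2) \<le> \<mu> + C * \<mu>\<^sup>2" .
  have var: "variance Y \<le> \<mu> + C * \<mu>\<^sup>2 - \<mu>\<^sup>2"
    using variance_eq[OF iY iY2] EY2 by (simp add: EY)
  have "\<mu> > 0" using pos by (simp add: \<mu>_def)
  have "prob (space M - (\<Union>j\<in>J. E j)) \<le> prob {\<omega>\<in>space M. \<mu> \<le> \<bar>Y \<omega> - expectation Y\<bar>}"
  proof (rule finite_measure_mono)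
    show "space M - (\<Union>j\<in>J. E j) \<subseteq> {\<omega>\<in>space M. \<mu> \<le> \<bar>Y \<omega> - expectation Y\<bar>}"
    proof
      fix \<omega> assume *: "\<omega> \<in> space M - (\<Union>j\<in>J. E j)"
      hence "Y \<omega> = 0" by (auto simp: Y_def)
      with * show "\<omega> \<in> {\<omega>\<in>space M. \<mu> \<le> \<bar>Y \<omega> - expectation Y\<bar>}"
        using EY \<open>\<mu> > 0\<close> by simp
    qed
  qed measurable
  also have "\<dots> \<le> variance Y / \<mu>\<^sup>2"
    by (rule Chebyshev_inequality) (use iY2 \<open>\<mu> > 0\<close> in auto)
  also have "\<dots> \<le> (\<mu> + C * \<mu>\<^sup>2 - \<mu>\<^sup>2) / \<mu>\<^sup>2"
    using var by (intro divide_right_mono) auto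
  also have "\<dots> = 1 / \<mu> + C - 1"
    using \<open>\<mu> > 0\<close> by (simp add: field_simps power2_eq_square)
  finally show ?thesis unfolding \<mu>_def .
qed

section \<open>The random draws\<close>

text \<open>The parameter \<open>N = n - 1\<close> counts the edges, which are what is drawn.\<close>

locale uniform_draws =
  fixes M :: "'a measure" and N :: nat and D :: "nat \<Rightarrow> 'a \<Rightarrow> nat"
  assumes N_pos: "N \<ge> 1" and iid: "iid_uniform_draws M (Suc N) D"
begin

sublocale prob_space M
  using iid by (simp add: iid_uniform_draws_def)

lemma indep_draws: "indep_vars (\<lambda>_. count_space {1..N}) D UNIV"
  using iid by (simp add: iid_uniform_draws_def)

lemma measurable_draw [measurable]: "D u \<in> measurable M (count_space {1..N})"
  using indep_draws by (auto simp: indep_vars_def)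

lemma measurable_draw_nat [measurable]: "D u \<in> measurable M (count_space UNIV)"
  by (rule measurable_compose[OF measurable_draw[of u], of "\<lambda>x. x"]) auto

lemma draw_in_range: "\<omega> \<in> space M \<Longrightarrow> D u \<omega> \<in> {1..N}"
  using measurable_space[OF measurable_draw] by simp

lemma prob_draw:
  assumes "A \<subseteq> {1..N}"
  shows "prob (D u -` A \<inter> space M) = card A / N"
proof -
  have "prob (D u -` A \<inter> space M) = measure (distr M (count_space {1..N}) (D u)) A"
    using assms by (subst measure_distr[OF measurable_draw]) auto
  also have "\<dots> = measure (uniform_count_measure {1..N}) A"
    using iid by (simp add: iid_uniform_draws_def)
  finally show ?thesis
    using assms by (simp add: measure_uniform_count_measure)
qed

lemma prob_cylinder:
  assumes A: "\<And>u. u < t \<Longrightarrow> A u \<subseteq> {1..N}"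
  shows "prob {\<omega>\<in>space M. \<forall>u<t. D u \<omega> \<in> A u} = (\<Prod>u<t. card (A u) / N)"
proof (cases "t = 0")
  case True
  thus ?thesis by (simp add: prob_space)
next
  case False
  have "{\<omega>\<in>space M. \<forall>u<t. D u \<omega> \<in> A u} = (\<Inter>u\<in>{..<t}. D u -` A u \<inter> space M)"
    using False by auto
  also have "prob \<dots> = (\<Prod>u<t. prob (D u -` A u \<inter> space M))"
    using A False by (intro indep_varsD[OF indep_draws]) auto
  also have "\<dots> = (\<Prod>u<t. card (A u) / N)"
    using A by (intro prod.cong) (auto simp: prob_draw)
  finally show ?thesis .
qed

lemma sets_cylinder [measurable]: "{\<omega>\<in>space M. \<forall>u<t. D u \<omega> \<in> A u} \<in> events"
  by measurable

lemma measurable_site [measurable]: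
  "(\<lambda>\<omega>. page_process (\<lambda>u. D u \<omega>) t j) \<in> measurable M (count_space UNIV)"
proof (induction t arbitrary: j)
  case 0
  show ?case by simp
next
  case (Suc t)
  note Suc [measurable]
  have "(\<lambda>\<omega>. try_park i (page_process (\<lambda>u. D u \<omega>) t) j) \<in> measurable M (count_space UNIV)" for i
    unfolding try_park_def fun_upd_def if_distrib[of "\<lambda>f. f j"] by measurable
  from measurable_compose_countable[OF this measurable_draw_nat[of t]]
  show ?case by simp
qed

lemma measurable_parking_time [measurable]:
  "(\<lambda>\<omega>. parking_time n (\<lambda>u. D u \<omega>)) \<in> measurable M (count_space UNIV)"
proof -
  let ?T = "\<lambda>\<omega>. parking_time n (\<lambda>u. D u \<omega>)"
  have le [measurable]: "Measurable.pred M (\<lambda>\<omega>. ?T \<omega> \<le> enat t)" for t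
    unfolding parking_time_le_iff parking_possible_def by measurable
  have eq: "Measurable.pred M (\<lambda>\<omega>. ?T \<omega> = e)" for e
  proof (cases e)
    case (enat t)
    have "?T \<omega> = e \<longleftrightarrow> ?T \<omega> \<le> enat t \<and> (\<forall>s<t. \<not> ?T \<omega> \<le> enat s)" for \<omega>
      unfolding enat by (cases "?T \<omega>") (auto simp: not_le, metis order_less_irrefl order_le_less)
    thus ?thesis by simp
  next
    case infinity
    have "?T \<omega> = e \<longleftrightarrow> (\<forall>s. \<not> ?T \<omega> \<le> enat s)" for \<omega>
      unfolding infinity by (cases "?T \<omega>") auto
    thus ?thesis by simp
  qed
  have "?T -` {e} \<inter> space M = {\<omega>\<in>space M. ?T \<omega> = e}" for e by auto
  thus ?thesis
    using eq by (subst measurable_count_space_eq2_countable) (auto simp: pred_def)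
qed

section \<open>Upper tail\<close>

text \<open>A union bound over the edge that has never been drawn.\<close>

lemma prob_parking_time_gt:
  "prob {\<omega>\<in>space M. enat t < parking_time (Suc N) (\<lambda>u. D u \<omega>)} \<le> N * (1 - 1 / N) ^ t"
proof -
  let ?E = "\<lambda>i. {\<omega>\<in>space M. \<forall>u<t. D u \<omega> \<in> {1..N} - {i}}"
  have sub: "{\<omega>\<in>space M. enat t < parking_time (Suc N) (\<lambda>u. D u \<omega>)} \<subseteq> (\<Union>i\<in>{1..N}. ?E i)"
  proof
    fix \<omega> assume *: "\<omega> \<in> {\<omega>\<in>space M. enat t < parking_time (Suc N) (\<lambda>u. D u \<omega>)}"
    hence "parking_possible (Suc N) (page_process (\<lambda>u. D u \<omega>) t)"
      using parking_time_le_iff[of "Suc N" "\<lambda>u. D u \<omega>" t] by auto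
    then obtain i where i: "i \<in> {1..N}" "page_process (\<lambda>u. D u \<omega>) t i = 0"
        "page_process (\<lambda>u. D u \<omega>) t (i + 1) = 0"
      by (auto simp: parking_possible_def)
    hence "\<forall>u<t. D u \<omega> \<noteq> i"
      using drawn_edge_blocked[of _ t "\<lambda>u. D u \<omega>" i] by auto
    with * i(1) draw_in_range show "\<omega> \<in> (\<Union>i\<in>{1..N}. ?E i)" by auto
  qed
  have "prob {\<omega>\<in>space M. enat t < parking_time (Suc N) (\<lambda>u. D u \<omega>)} \<le> prob (\<Union>i\<in>{1..N}. ?E i)"
    by (intro finite_measure_mono sub) (auto intro!: sets.finite_UN sets_cylinder)
  also have "\<dots> \<le> (\<Sum>i\<in>{1..N}. prob (?E i))"
    by (intro finite_measure_subadditive_finite) (auto intro!: sets_cylinder)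
  also have "\<dots> = (\<Sum>i\<in>{1..N}. (1 - 1 / N) ^ t)"
  proof (intro sum.cong refl)
    fix i assume "i \<in> {1..N}"
    hence "real (card ({1..N} - {i})) / N = 1 - 1 / N"
      by (simp add: of_nat_diff field_simps)
    thus "prob (?E i) = (1 - 1 / N) ^ t"
      by (subst prob_cylinder) auto
  qed
  finally show ?thesis by simp
qed

section \<open>Lower tail\<close>

text \<open>
  The edges allowed at time \<open>u\<close> when the middle pair of the block \<open>7 * k + 1, \<dots>, 7 * k + 7\<close> is to be
  guarded from both sides by cars parking at times \<open>a\<close> and \<open>b\<close> and to be empty at the end. Fixing the
  times, rather than only asking that such times exist, makes the event a product event.
\<close>

definition guarded_draws :: "nat \<Rightarrow> nat \<times> nat \<times> nat \<Rightarrow> nat \<Rightarrow> nat set" where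
  "guarded_draws r = (\<lambda>(k, a, b) u.
     if u = a then {7 * k + 2} else if u = b then {7 * k + 6}
     else if u < 2 * r then {1..N} - {7 * k + 1..7 * k + 7} else {1..N} - {7 * k + 4})"

definition guarded_event :: "nat \<Rightarrow> nat \<Rightarrow> nat \<times> nat \<times> nat \<Rightarrow> 'a set" where
  "guarded_event r t j = {\<omega>\<in>space M. \<forall>u<t. D u \<omega> \<in> guarded_draws r j u}"

text \<open>Taking \<open>a\<close> and \<open>b\<close> from disjoint ranges ensures \<open>a \<noteq> b\<close>.\<close>

definition guard_choices :: "nat \<Rightarrow> (nat \<times> nat \<times> nat) set" where
  "guard_choices r = {..<N div 7} \<times> {..<r} \<times> {r..<2 * r}"

lemma block_in_range: "k < N div 7 \<Longrightarrow> 7 * k + 7 \<le> N"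
  by linarith

lemma guarded_draws_range:
  "j \<in> guard_choices r \<Longrightarrow> guarded_draws r j u \<subseteq> {1..N}"
  by (auto simp: guard_choices_def guarded_draws_def split: if_splits dest: block_in_range)

lemma guarded_event_parking_time:
  assumes j: "j \<in> guard_choices r" and "2 * r \<le> t" and \<omega>: "\<omega> \<in> guarded_event r t j"
  shows "enat t < parking_time (Suc N) (\<lambda>u. D u \<omega>)"
proof -
  obtain k a b where kab: "j = (k, a, b)" "k < N div 7" "a < r" "r \<le> b" "b < 2 * r"
    using j by (auto simp: guard_choices_def)
  have D: "D u \<omega> \<in> guarded_draws r (k, a, b) u" if "u < t" for u
    using \<omega> that kab(1) by (simp add: guarded_event_def)
  have "page_process (\<lambda>u. D u \<omega>) t (7 * k + 4) = 0 \<and> page_process (\<lambda>u. D u \<omega>) t (7 * k + 5) = 0"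
  proof (rule guarded_pair_stays_empty)
    show "a \<noteq> b" "a < 2 * r" "b < 2 * r" "2 * r \<le> t" using kab assms(2) by auto
    show "D a \<omega> = 7 * k + 2" "D b \<omega> = 7 * k + 6"
      using D[of a] D[of b] kab assms(2) by (auto simp: guarded_draws_def)
    show "D u \<omega> \<notin> {7 * k + 1..7 * k + 7}" if "u < 2 * r" "u \<noteq> a" "u \<noteq> b" for u
      using D[of u] that assms(2) by (simp add: guarded_draws_def)
    show "D u \<omega> \<noteq> 7 * k + 4" if "2 * r \<le> u" "u < t" for u
      using D[of u] that kab by (simp add: guarded_draws_def)
  qed
  hence "parking_possible (Suc N) (page_process (\<lambda>u. D u \<omega>) t)"
    using block_in_range[OF kab(2)] unfolding parking_possible_def
    by (intro bexI[of _ "7 * k + 4"]) (auto simp: add.commute)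
  thus ?thesis
    using parking_time_le_iff[of "Suc N" "\<lambda>u. D u \<omega>" t] by (meson not_le)
qed

lemma prob_guarded_event:
  "j \<in> guard_choices r \<Longrightarrow>
    prob (guarded_event r t j) = (\<Prod>u<t. card (guarded_draws r j u) / N)"
  unfolding guarded_event_def by (intro prob_cylinder guarded_draws_range)

lemma prob_guarded_event_inter:
  assumes "i \<in> guard_choices r"
  shows "prob (guarded_event r t i \<inter> guarded_event r t j) =
    (\<Prod>u<t. card (guarded_draws r i u \<inter> guarded_draws r j u) / N)"
proof -
  have "guarded_event r t i \<inter> guarded_event r t j =
      {\<omega>\<in>space M. \<forall>u<t. D u \<omega> \<in> guarded_draws r i u \<inter> guarded_draws r j u}"
    by (auto simp: guarded_event_def)
  thus ?thesis
    using guarded_draws_range[OF assms] prob_cylinder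
      [of t "\<lambda>u. guarded_draws r i u \<inter> guarded_draws r j u"] by (metis le_infI1)
qed

lemma frac_range_minus_set:
  assumes "B \<subseteq> {1..N}"
  shows "real (card ({1..N} - B)) / N = 1 - card B / N"
proof -
  have "card B \<le> N" using card_mono[OF _ assms] by simp
  thus ?thesis
    using N_pos assms by (subst card_Diff_subset) (auto simp: finite_subset of_nat_diff field_simps)
qed

lemma guarded_draws_frac:
  assumes "(k, a, b) \<in> guard_choices r"
  shows "card (guarded_draws r (k, a, b) u) / N =
    (if u = a \<or> u = b then 1 / N else if u < 2 * r then 1 - 7 / N else 1 - 1 / N)"
  using assms block_in_range[of k] frac_range_minus_set[of "{7 * k + 1..7 * k + 7}"]
    frac_range_minus_set[of "{7 * k + 4}"]
  by (auto simp: guarded_draws_def guard_choices_def)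

text \<open>
  The weight \<open>w\<close> in the proof charges the factor \<open>1 - 1/N\<close> to all times and \<open>1 - 7/N\<close> to all early
  ones, also where this is wasteful; for large \<open>N\<close> the loss is a constant factor, and the product over
  time splits into powers.
\<close>

lemma prob_guarded_event_ge:
  assumes j: "j \<in> guard_choices r" and "2 * r \<le> t"
  shows "prob (guarded_event r t j) \<ge> (1 / N)\<^sup>2 * (1 - 7 / N) ^ (2 * r) * (1 - 1 / N) ^ t"
proof -
  obtain k a b where kab: "j = (k, a, b)" "k < N div 7" "a < r" "r \<le> b" "b < 2 * r"
    using j by (auto simp: guard_choices_def)
  have "N \<ge> 7" using block_in_range[OF kab(2)] by linarith
  define w where "w = (\<lambda>u. (if u = a then 1 / N else 1) * (if u = b then 1 / N else 1) *
    (if u < 2 * r then 1 - 7 / N else 1) * (1 - 1 / real N))"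
  have "{..<t} \<inter> {u. u < 2 * r} = {..<2 * r}" using assms(2) by auto
  hence "(\<Prod>u<t. if u < 2 * r then 1 - 7 / real N else 1) = (1 - 7 / N) ^ (2 * r)"
    by (simp add: prod.If_cases)
  hence "(\<Prod>u<t. w u) = (1 / N)\<^sup>2 * (1 - 7 / N) ^ (2 * r) * (1 - 1 / N) ^ t"
    using kab assms(2) by (simp add: w_def prod.distrib prod.delta power2_eq_square)
  moreover have "(\<Prod>u<t. w u) \<le> (\<Prod>u<t. card (guarded_draws r j u) / N)"
  proof (rule prod_mono, intro conjI)
    fix u
    have b: "0 \<le> 1 - 7 / real N" "1 - 7 / real N \<le> 1" "0 \<le> 1 - 1 / real N" "1 - 1 / real N \<le> 1"
        "0 \<le> 1 / real N"
      using \<open>N \<ge> 7\<close> by (auto simp: field_simps)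
    show "0 \<le> w u" using b by (auto simp: w_def)
    have "(1 - 7 / real N) * (1 - 1 / real N) / N \<le> 1 / N"
      using b by (intro divide_right_mono mult_le_one) auto
    thus "w u \<le> card (guarded_draws r j u) / N"
      unfolding kab(1) guarded_draws_frac[OF j[unfolded kab(1)]] w_def
      using kab b by (auto intro: mult_le_one mult_left_le_one_le mult_right_le_one_le divide_right_mono)
  qed
  ultimately show ?thesis
    using prob_guarded_event[OF j] by simp
qed

text \<open>
  At a time when only one of the blocks prescribes an edge, the intersection contains at most that
  edge, whereas the product of the two fractions has the additional
  factor \<open>1 - 7/N\<close>, which the correction cancels. At a time prescribed by both blocks the
  intersection is empty. At all other times the fractions multiply to at least that of the
  intersection.
\<close>

lemma guarded_draws_inter_frac_le:
  assumes i: "(k, a, b) \<in> guard_choices r" and j: "(l, c, d) \<in> guard_choices r" and "k \<noteq> l"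
    and "N \<ge> 14"
  shows "card (guarded_draws r (k, a, b) u \<inter> guarded_draws r (l, c, d) u) / N \<le>
    card (guarded_draws r (k, a, b) u) / N * (card (guarded_draws r (l, c, d) u) / N) *
    (if u \<in> {a, b, c, d} then 1 / (1 - 7 / N) else 1)"
proof -
  define x where "x = 1 / real N"
  have x: "0 < x" "7 * x < 1" "14 * x \<le> 1"
    using assms(4) by (auto simp: x_def field_simps)
  have bounds: "7 * k + 7 \<le> N" "7 * l + 7 \<le> N"
    using i j block_in_range by (auto simp: guard_choices_def)
  have sep: "k \<ge> Suc l \<or> l \<ge> Suc k" using \<open>k \<noteq> l\<close> by linarith
  have disj: "{7 * k + 1..7 * k + 7} \<inter> {7 * l + 1..7 * l + 7} = {}"
    using sep by auto
  let ?I = "guarded_draws r (k, a, b) u \<inter> guarded_draws r (l, c, d) u"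
  note fi = guarded_draws_frac[OF i, of u] and fj = guarded_draws_frac[OF j, of u]
  have abcd: "a < 2 * r" "b < 2 * r" "c < 2 * r" "d < 2 * r"
    using i j by (auto simp: guard_choices_def)
  consider "u \<in> {a, b}" "u \<in> {c, d}" | "u \<in> {a, b}" "u \<notin> {c, d}"
    | "u \<notin> {a, b}" "u \<in> {c, d}" | "u \<notin> {a, b, c, d}" "u < 2 * r"
    | "u \<notin> {a, b, c, d}" "u \<ge> 2 * r"
    by force
  thus ?thesis
  proof cases
    case 1
    have "7 * k + x \<noteq> 7 * l + y" if "x < 7" "y < 7" for x y
      using sep that by linarith
    from this[of 2 2] this[of 2 6] this[of 6 2] this[of 6 6] 1 have "?I = {}"
      by (auto simp: guarded_draws_def)
    thus ?thesis using x(2) by (simp add: x_def)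
  next
    case 2
    have "card ?I \<le> card (guarded_draws r (k, a, b) u)"
      using finite_subset[OF guarded_draws_range[OF i]] by (intro card_mono) auto
    hence "card ?I / N \<le> card (guarded_draws r (k, a, b) u) / N"
      by (intro divide_right_mono) auto
    thus ?thesis using fi fj 2 abcd x by (auto simp: x_def)
  next
    case 3
    have "card ?I \<le> card (guarded_draws r (l, c, d) u)"
      using finite_subset[OF guarded_draws_range[OF j]] by (intro card_mono) auto
    hence "card ?I / N \<le> card (guarded_draws r (l, c, d) u) / N"
      by (intro divide_right_mono) auto
    thus ?thesis using fi fj 3 abcd x by (auto simp: x_def)
  next
    case 4
    hence "?I = {1..N} - ({7 * k + 1..7 * k + 7} \<union> {7 * l + 1..7 * l + 7})"
      by (auto simp: guarded_draws_def)
    moreover have "card ({7 * k + 1..7 * k + 7} \<union> {7 * l + 1..7 * l + 7}) = 14"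
      using disj by (subst card_Un_disjoint) auto
    moreover have "{7 * k + 1..7 * k + 7} \<union> {7 * l + 1..7 * l + 7} \<subseteq> {1..N}"
      using bounds by auto
    ultimately have "card ?I / N = 1 - 14 / N"
      using frac_range_minus_set by (metis of_nat_numeral)
    moreover have "1 - 14 * x \<le> (1 - 7 * x) * (1 - 7 * x)"
      by (simp add: algebra_simps)
    ultimately show ?thesis using fi fj 4 by (simp add: x_def)
  next
    case 5
    hence "?I = {1..N} - {7 * k + 4, 7 * l + 4}"
      using abcd by (auto simp: guarded_draws_def)
    moreover have "card {7 * k + 4, 7 * l + 4} = 2"
      using \<open>k \<noteq> l\<close> by simp
    moreover have "{7 * k + 4, 7 * l + 4} \<subseteq> {1..N}"
      using bounds by auto
    ultimately have "card ?I / N = 1 - 2 / N"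
      using frac_range_minus_set by (metis of_nat_numeral)
    moreover have "1 - 2 * x \<le> (1 - x) * (1 - x)"
      by (simp add: algebra_simps)
    ultimately show ?thesis using fi fj 5 by (simp add: x_def)
  qed
qed

text \<open>The history of a block determines the times of its guards.\<close>

lemma guarded_event_same_block_disjoint:
  assumes i: "(k, a, b) \<in> guard_choices r" and j: "(k, c, d) \<in> guard_choices r"
    and "(a, b) \<noteq> (c, d)" "2 * r \<le> t"
  shows "guarded_event r t (k, a, b) \<inter> guarded_event r t (k, c, d) = {}"
proof -
  have abcd: "a < r" "r \<le> b" "b < 2 * r" "c < r" "r \<le> d" "d < 2 * r"
    using i j by (auto simp: guard_choices_def)
  obtain u where "u < t" "guarded_draws r (k, a, b) u \<inter> guarded_draws r (k, c, d) u = {}"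
  proof (cases "a = c")
    case False
    thus ?thesis using abcd assms(4) by (intro that[of a]) (auto simp: guarded_draws_def)
  next
    case True
    thus ?thesis using abcd assms(3,4) by (intro that[of b]) (auto simp: guarded_draws_def)
  qed
  thus ?thesis by (auto simp: guarded_event_def)
qed

lemma guarded_events_almost_uncorrelated:
  assumes i: "i \<in> guard_choices r" and j: "j \<in> guard_choices r" and "i \<noteq> j"
    and "N \<ge> 14" "2 * r \<le> t"
  shows "prob (guarded_event r t i \<inter> guarded_event r t j) \<le>
    (1 / (1 - 7 / N)) ^ 4 * (prob (guarded_event r t i) * prob (guarded_event r t j))"
proof -
  obtain k a b l c d where eqs: "i = (k, a, b)" "j = (l, c, d)"
    by (metis prod.exhaust)
  define \<kappa> where "\<kappa> = 1 / (1 - 7 / real N)"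
  have \<kappa>: "\<kappa> \<ge> 1" using \<open>N \<ge> 14\<close> by (simp add: \<kappa>_def field_simps)
  show ?thesis
  proof (cases "k = l")
    case True
    hence "guarded_event r t i \<inter> guarded_event r t j = {}"
      using guarded_event_same_block_disjoint[of k a b r c d t] assms eqs by simp
    thus ?thesis using \<kappa> by (simp add: \<kappa>_def[symmetric] del: power_one_over)
  next
    case False
    let ?f = "\<lambda>j u. card (guarded_draws r j u) / real N"
    have "prob (guarded_event r t i \<inter> guarded_event r t j) =
        (\<Prod>u<t. card (guarded_draws r i u \<inter> guarded_draws r j u) / N)"
      by (rule prob_guarded_event_inter[OF i])
    also have "\<dots> \<le> (\<Prod>u<t. ?f i u * ?f j u * (if u \<in> {a, b, c, d} then \<kappa> else 1))"
      using guarded_draws_inter_frac_le[OF i[unfolded eqs] j[unfolded eqs] False \<open>N \<ge> 14\<close>]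
      unfolding eqs \<kappa>_def by (intro prod_mono) auto
    also have "\<dots> = prob (guarded_event r t i) * prob (guarded_event r t j) *
        (\<Prod>u<t. if u \<in> {a, b, c, d} then \<kappa> else 1)"
      by (simp only: prod.distrib prob_guarded_event[OF i] prob_guarded_event[OF j])
    also have "(\<Prod>u<t. if u \<in> {a, b, c, d} then \<kappa> else 1) = \<kappa> ^ card ({..<t} \<inter> {a, b, c, d})"
      by (subst prod.inter_restrict[symmetric]) auto
    also have "prob (guarded_event r t i) * prob (guarded_event r t j) * \<dots> \<le>
        prob (guarded_event r t i) * prob (guarded_event r t j) * \<kappa> ^ 4"
    proof (intro mult_left_mono power_increasing[OF _ \<kappa>])
      have "card ({..<t} \<inter> {a, b, c, d}) \<le> card {a, b, c, d}"
        by (intro card_mono) auto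
      also have "\<dots> \<le> 4" using card_length[of "[a, b, c, d]"] by simp
      finally show "card ({..<t} \<inter> {a, b, c, d}) \<le> 4" .
    qed simp
    finally show ?thesis
      unfolding \<kappa>_def by (simp only: mult.commute)
  qed
qed

text \<open>
  There are at least \<open>N/14\<close> blocks and \<open>(N/56)^2\<close> pairs of times, and avoiding a block for \<open>2 r \<le> N/14\<close>
  draws has probability at least \<open>1/2\<close>. Hence the expected number of guarded events is at least
  \<open>N (1 - 1/N)^t\<close> divided by \<open>87808 = 2 * 14 * 56 * 56\<close>.
\<close>

lemma prob_parking_time_le:
  assumes "N \<ge> 56" and t: "2 * (N div 28) \<le> t"
  shows "prob {\<omega>\<in>space M. parking_time (Suc N) (\<lambda>u. D u \<omega>) \<le> enat t} \<le>
    87808 / (N * (1 - 1 / N) ^ t) + (1 / (1 - 7 / N)) ^ 4 - 1"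
proof -
  define r where "r = N div 28"
  define J where "J = guard_choices r"
  define \<mu> where "\<mu> = (\<Sum>j\<in>J. prob (guarded_event r t j))"
  define \<nu> where "\<nu> = N * (1 - 1 / real N) ^ t / 87808"
  have "\<nu> > 0" using assms(1) by (auto simp: \<nu>_def)
  have r: "real r \<ge> N / 56" "28 * real r \<le> N"
    using assms(1) unfolding r_def by linarith+
  have m: "real (N div 7) \<ge> N / 14"
    using assms(1) by linarith
  have "1 / 2 \<le> 1 + real (2 * r) * (- 7 / N)"
    using r(2) assms(1) by (simp add: field_simps)
  also have "\<dots> \<le> (1 + (- 7 / N)) ^ (2 * r)"
    using assms(1) by (intro Bernoulli_inequality) (simp add: field_simps)
  finally have bern: "1 / 2 \<le> (1 - 7 / real N) ^ (2 * r)" by simp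
  have "\<nu> = (N / 14 * (N / 56) * (N / 56)) * ((1 / real N)\<^sup>2 * (1 / 2) * (1 - 1 / N) ^ t)"
    using assms(1) by (simp add: \<nu>_def power2_eq_square)
  also have "\<dots> \<le> (real (N div 7) * r * r) *
      ((1 / real N)\<^sup>2 * (1 - 7 / N) ^ (2 * r) * (1 - 1 / N) ^ t)"
    using r m bern assms(1) by (intro mult_mono) auto
  also have "\<dots> = (\<Sum>j\<in>J. (1 / real N)\<^sup>2 * (1 - 7 / N) ^ (2 * r) * (1 - 1 / N) ^ t)"
    by (simp add: J_def guard_choices_def)
  also have "\<dots> \<le> \<mu>"
    unfolding \<mu>_def J_def using t by (intro sum_mono prob_guarded_event_ge) (auto simp: r_def)
  finally have "\<nu> \<le> \<mu>" .
  have "prob {\<omega>\<in>space M. parking_time (Suc N) (\<lambda>u. D u \<omega>) \<le> enat t} \<le>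
      prob (space M - (\<Union>j\<in>J. guarded_event r t j))"
  proof (rule finite_measure_mono)
    show "{\<omega>\<in>space M. parking_time (Suc N) (\<lambda>u. D u \<omega>) \<le> enat t} \<subseteq>
        space M - (\<Union>j\<in>J. guarded_event r t j)"
      using guarded_event_parking_time[of _ r t] t unfolding J_def r_def
      by (fastforce simp: not_le[symmetric])
    show "space M - (\<Union>j\<in>J. guarded_event r t j) \<in> events"
      unfolding guarded_event_def J_def guard_choices_def
      by (intro sets.Diff sets.top sets.finite_UN sets_cylinder) auto
  qed
  also have "\<dots> \<le> 1 / \<mu> + (1 / (1 - 7 / N)) ^ 4 - 1"
    unfolding \<mu>_def
  proof (rule second_moment_bound)
    show "finite J" by (simp add: J_def guard_choices_def)
    show "guarded_event r t j \<in> events" for j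
      unfolding guarded_event_def by (rule sets_cylinder)
    show "prob (guarded_event r t i \<inter> guarded_event r t j) \<le>
        (1 / (1 - 7 / N)) ^ 4 * (prob (guarded_event r t i) * prob (guarded_event r t j))"
      if "i \<in> J" "j \<in> J" "i \<noteq> j" for i j
      using guarded_events_almost_uncorrelated[of i r j t] that assms by (simp add: J_def r_def)
    show "0 \<le> (1 / (1 - 7 / real N)) ^ 4" by simp
    show "0 < (\<Sum>j\<in>J. prob (guarded_event r t j))"
      using \<open>\<nu> > 0\<close> \<open>\<nu> \<le> \<mu>\<close> by (simp add: \<mu>_def)
  qed
  also have "1 / \<mu> \<le> 1 / \<nu>"
    using \<open>\<nu> > 0\<close> \<open>\<nu> \<le> \<mu>\<close> by (intro divide_left_mono) auto
  finally show ?thesis by (simp add: \<nu>_def)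
qed

end

section \<open>Convergence in probability\<close>

theorem theorem7:
  fixes M :: "nat \<Rightarrow> 'a measure" and D :: "nat \<Rightarrow> nat \<Rightarrow> 'a \<Rightarrow> nat"
  assumes "\<And>n. n \<ge> 2 \<Longrightarrow> iid_uniform_draws (M n) n (D n)"
  defines "T \<equiv> \<lambda>n \<omega>. parking_time n (\<lambda>t. D n t \<omega>)"
  shows "tendsto_in_prob M (\<lambda>n \<omega>. ereal_of_enat (T n \<omega>) / ereal (real n * ln (real n))) 1"
proof -
  let ?X = "\<lambda>n \<omega>. ereal_of_enat (T n \<omega>) / ereal (real n * ln (real n))"
  have draws: "uniform_draws (M n) (n - 1) (D n)" if "n \<ge> 2" for n
    using assms(1)[OF that] that by unfold_locales auto
  have T_meas: "T n \<in> measurable (M n) (count_space UNIV)" if "n \<ge> 2" for n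
    unfolding T_def by (rule uniform_draws.measurable_parking_time[OF draws[OF that]])
  have X_meas: "?X n \<in> borel_measurable (M n)" if "n \<ge> 2" for n
    by (rule measurable_compose[OF T_meas[OF that]]) simp
  have lim: "(\<lambda>n. measure (M n) {\<omega> \<in> space (M n). \<bar>?X n \<omega> - ereal 1\<bar> > ereal \<epsilon>}) \<longlonglongrightarrow> 0"
    if "\<epsilon> > 0" for \<epsilon> :: real
  proof -
    \<comment> \<open>Shrinking \<open>\<epsilon>\<close> below \<open>1\<close> makes the lower threshold \<open>(1 - \<delta>) n ln n\<close> positive.\<close>
    define \<delta> where "\<delta> = min \<epsilon> (1 / 2)"
    have \<delta>: "0 < \<delta>" "\<delta> \<le> \<epsilon>" "\<delta> < 1" using that by (auto simp: \<delta>_def)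
    \<comment> \<open>The two tail bounds at times \<open>(1 \<plusminus> \<delta>) n ln n\<close>, with the exponents simplified to
      linear functions of \<open>ln n\<close> at the cost of a constant factor.\<close>
    define up where "up = (\<lambda>n::nat. (real n - 1) *
      exp (1 - (1 + \<delta>) * ln (real n)))"
    define low where "low = (\<lambda>n::nat. 87808 / ((real n - 1) *
      exp (- ((1 - \<delta>) * (ln (real n) + 1)))) +
      (1 / (1 - 7 / (real n - 1))) ^ 4 - 1)"
    have "up \<longlonglongrightarrow> 0"
      unfolding up_def using \<delta> by real_asymp
    moreover have "low \<longlonglongrightarrow> 0"
      unfolding low_def using \<delta> by real_asymp
    ultimately have lim0: "(\<lambda>n. up n + low n) \<longlonglongrightarrow> 0"
      using tendsto_add[of up 0 _ low 0] by simp
    \<comment> \<open>The early phase of the lower bound, of length about \<open>n / 14\<close>, has to end before the time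
      considered.\<close>
    have "eventually (\<lambda>n. real n / 14 \<le> (1 - \<delta>) * (real n * ln (real n)) - 1) sequentially"
      using \<delta> by real_asymp
    moreover have "eventually (\<lambda>n. - (ln (real n) + 1) \<le>
        real n * ln (real n) * ln (1 - 1 / (real n - 1))) sequentially"
      by real_asymp
    moreover have "eventually (\<lambda>n. n \<ge> 57) sequentially"
      by (rule eventually_ge_at_top)
    ultimately have bound: "eventually (\<lambda>n.
        measure (M n) {\<omega> \<in> space (M n). \<bar>?X n \<omega> - ereal 1\<bar> > ereal \<epsilon>} \<le> up n + low n) sequentially"
    proof eventually_elim
      case (elim n)
      define c where "c = real n * ln (real n)"
      have "c > 0" using elim by (simp add: c_def)
      interpret uniform_draws "M n" "n - 1" "D n" by (rule draws) (use elim in auto)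
      have [simp]: "Suc (n - Suc 0) = n" "real (n - Suc 0) = real n - 1" using elim by auto
      define s where "s = nat \<lfloor>(1 + \<delta>) * c\<rfloor>"
      define t where "t = nat \<lfloor>(1 - \<delta>) * c\<rfloor>"
      have nonneg: "0 \<le> (1 + \<delta>) * c" "0 \<le> (1 - \<delta>) * c" using \<delta> \<open>c > 0\<close> by auto
      have s: "real s \<le> (1 + \<delta>) * c" "(1 + \<delta>) * c - 1 \<le> real s"
        unfolding s_def using nonneg by linarith+
      have t: "real t \<le> (1 - \<delta>) * c" "(1 - \<delta>) * c - 1 \<le> real t"
        unfolding t_def using nonneg by linarith+
      let ?S = "{\<omega> \<in> space (M n). enat s < T n \<omega>}"
      let ?L = "{\<omega> \<in> space (M n). T n \<omega> \<le> enat t}"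
      have sets: "?S \<in> sets (M n)" "?L \<in> sets (M n)"
        using measurable_sets[OF T_meas, of n "{enat s<..}"]
          measurable_sets[OF T_meas, of n "{..enat t}"] elim
        by (auto simp: vimage_def Int_def conj_commute)
      have "{\<omega> \<in> space (M n). \<bar>?X n \<omega> - ereal 1\<bar> > ereal \<epsilon>} \<subseteq> ?S \<union> ?L"
      proof
        fix \<omega> assume "\<omega> \<in> {\<omega> \<in> space (M n). \<bar>?X n \<omega> - ereal 1\<bar> > ereal \<epsilon>}"
        hence \<omega>: "\<omega> \<in> space (M n)" and far: "\<bar>?X n \<omega> - ereal 1\<bar> > ereal \<epsilon>" by auto
        show "\<omega> \<in> ?S \<union> ?L"
        proof (cases "T n \<omega>")
          case infinity
          thus ?thesis using \<omega> by simp
        next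
          case (enat v)
          hence "\<bar>v / c - 1\<bar> > \<epsilon>"
            using far \<open>c > 0\<close> by (simp add: c_def[symmetric] one_ereal_def)
          hence "v / c > 1 + \<delta> \<or> v / c < 1 - \<delta>" using \<delta> by linarith
          hence "v > (1 + \<delta>) * c \<or> v < (1 - \<delta>) * c"
            using \<open>c > 0\<close> by (auto simp: field_simps)
          hence "v > s \<or> v \<le> t"
            using s(1) unfolding t_def by linarith
          thus ?thesis using \<omega> enat by auto
        qed
      qed
      hence "prob {\<omega> \<in> space (M n). \<bar>?X n \<omega> - ereal 1\<bar> > ereal \<epsilon>} \<le> prob (?S \<union> ?L)"
        using sets by (intro finite_measure_mono) auto
      also have "\<dots> \<le> prob ?S + prob ?L"
        using sets by (intro measure_Un_le) auto
      also have "prob ?S \<le> up n"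
      proof -
        have "prob ?S \<le> (real n - 1) * (1 - 1 / (real n - 1)) ^ s"
          using prob_parking_time_gt[of s] by (simp add: T_def)
        also have "\<dots> \<le> (real n - 1) * exp (- 1 / (real n - 1)) ^ s"
          using elim exp_ge_add_one_self[of "- 1 / (real n - 1)"]
          by (intro mult_left_mono power_mono) (auto simp: field_simps)
        also have "exp (- 1 / (real n - 1)) ^ s = exp (- real s / (real n - 1))"
          by (simp add: exp_of_nat_mult[symmetric])
        also have "(real n - 1) * exp (- real s / (real n - 1)) \<le> up n"
        proof -
          have "((1 + \<delta>) * ln (real n) - 1) * (real n - 1) \<le> (1 + \<delta>) * c - 1"
          proof -
            have "0 \<le> (1 + \<delta>) * ln (real n)" using elim \<delta> by simp
            thus ?thesis using elim by (simp add: c_def algebra_simps)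
          qed
          hence "(1 + \<delta>) * ln (real n) - 1 \<le> real s / (real n - 1)"
            using s(2) elim by (subst pos_le_divide_eq) auto
          thus ?thesis
            unfolding up_def using elim by (intro mult_left_mono) auto
        qed
        finally show ?thesis .
      qed
      also have "prob ?L \<le> low n"
      proof -
        let ?q = "1 - 1 / (real n - 1)"
        have q: "0 < ?q" "?q \<le> 1" using elim by (auto simp: field_simps)
        have "2 * ((n - 1) div 28) \<le> t"
          using t(2) elim unfolding c_def[symmetric] by linarith
        hence "prob ?L \<le> 87808 / ((real n - 1) * ?q ^ t) + (1 / (1 - 7 / (real n - 1))) ^ 4 - 1"
          using prob_parking_time_le[of t] elim by (simp add: T_def)
        also have "87808 / ((real n - 1) * ?q ^ t) \<le>
            87808 / ((real n - 1) * exp (- ((1 - \<delta>) * (ln (real n) + 1))))"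
        proof -
          have "- ((1 - \<delta>) * (ln (real n) + 1)) = (1 - \<delta>) * - (ln (real n) + 1)"
            by (simp only: mult_minus_right)
          also have "\<dots> \<le> (1 - \<delta>) * (c * ln ?q)"
            using elim \<delta> unfolding c_def by (intro mult_left_mono) auto
          also have "\<dots> = (1 - \<delta>) * c * ln ?q" by simp
          also have "\<dots> \<le> t * ln ?q"
            using t(1) q by (intro mult_right_mono_neg) auto
          finally have "exp (- ((1 - \<delta>) * (ln (real n) + 1))) \<le> exp (t * ln ?q)" by simp
          also have "\<dots> = ?q ^ t"
            using q by (simp add: exp_of_nat_mult)
          finally show ?thesis
            using elim q by (intro divide_left_mono mult_left_mono mult_pos_pos) auto
        qed
        finally show ?thesis by (simp add: low_def)
      qed
      finally show ?case by simp
    qed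
    show ?thesis
      by (rule tendsto_sandwich[OF _ bound tendsto_const lim0]) simp
  qed
  show ?thesis
    unfolding tendsto_in_prob_def
  proof (intro conjI allI impI)
    show "\<forall>\<^sub>F n in sequentially. prob_space (M n) \<and> ?X n \<in> borel_measurable (M n)"
      using eventually_ge_at_top[of 2]
      by eventually_elim (use X_meas assms(1) in \<open>auto simp: iid_uniform_draws_def\<close>)
  qed (use lim in simp)
qed

end
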